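(* Let $p,q$ be primes with $q>p+1$ and let $A$ be an (additive) abelian group of order $p^2q$, with primary decomposition $A=A_p\oplus A_q$. Let $\cdot_1,\cdot_2$ be two multiplications on $A$, each making $A$ a (left) brace, which coincide on $A_p$. Then $\cdot_1$ and $\cdot_2$ define isomorphic brace structures on $A$ if and only if there is a brace automorphism $\varphi:A_p\to A_p$ such that $$\varphi(a)\cdot_2 b=a\cdot_1 b\qquad\text{for all } a\in A_p,\ b\in A_q.$$
   Context: A (left) brace is a (here finite) abelian group $(A,+)$ with a binary operation $\cdot$ such that for all $a,b,c\in A$: $a\cdot(b+c)=a\cdot b+a\cdot c$; $(a\cdot b+a+b)\cdot c=a\cdot(b\cdot c)+a\cdot c+b\cdot c$; and $x\mapsto a\cdot x+x$ is bijective. Isomorphisms (automorphisms) of braces are bijections preserving $+$ and $\cdot$. The primary components $A_p,A_q$ of the additive group satisfy $a\cdot A_p\subseteq A_p$, $a\cdot A_q\subseteq A_q$ for all $a\in A$, so they are braces under the restricted operations; "coincide on $A_p$" means $a\cdot_1 a'=a\cdot_2 a'$ for all $a,a'\in A_p$, and $A_p$ carries this common brace structure. *)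

theory Defs
  imports "HOL-Algebra.Algebra" "HOL-Computational_Algebra.Primes"
begin

text \<open>
  Finite abelian groups are commutative groups in the sense of HOL-Algebra, so the additive
  operation \<open>+\<close> of a brace is rendered as \<open>\<otimes>\<close>. The second operation of a brace is a separate
  parameter, so that one group can carry several brace structures.
\<close>

locale brace = comm_group G for G (structure) +
  fixes bmult :: "'a \<Rightarrow> 'a \<Rightarrow> 'a" (infixl \<open>\<cdot>\<close> 75)
  assumes bmult_closed: "\<lbrakk>a \<in> carrier G; b \<in> carrier G\<rbrakk> \<Longrightarrow> a \<cdot> b \<in> carrier G"
    and bmult_distrib:
      "\<lbrakk>a \<in> carrier G; b \<in> carrier G; c \<in> carrier G\<rbrakk> \<Longrightarrow> a \<cdot> (b \<otimes> c) = a \<cdot> b \<otimes> a \<cdot> c"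
    and bmult_circle:
      "\<lbrakk>a \<in> carrier G; b \<in> carrier G; c \<in> carrier G\<rbrakk> \<Longrightarrow>
        (a \<cdot> b \<otimes> a \<otimes> b) \<cdot> c = a \<cdot> (b \<cdot> c) \<otimes> a \<cdot> c \<otimes> b \<cdot> c"
    and bmult_bij:
      "a \<in> carrier G \<Longrightarrow> bij_betw (\<lambda>x. a \<cdot> x \<otimes> x) (carrier G) (carrier G)"

definition brace_iso ::
  "('a, 'c) monoid_scheme \<Rightarrow> ('a \<Rightarrow> 'a \<Rightarrow> 'a) \<Rightarrow>
   ('b, 'd) monoid_scheme \<Rightarrow> ('b \<Rightarrow> 'b \<Rightarrow> 'b) \<Rightarrow> ('a \<Rightarrow> 'b) set" where
  "brace_iso G m H n =
    {f \<in> iso G H. \<forall>a\<in>carrier G. \<forall>b\<in>carrier G. f (m a b) = n (f a) (f b)}"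

definition braces_isomorphic ::
  "('a, 'c) monoid_scheme \<Rightarrow> ('a \<Rightarrow> 'a \<Rightarrow> 'a) \<Rightarrow>
   ('b, 'd) monoid_scheme \<Rightarrow> ('b \<Rightarrow> 'b \<Rightarrow> 'b) \<Rightarrow> bool" where
  "braces_isomorphic G m H n \<longleftrightarrow> (\<exists>f. f \<in> brace_iso G m H n)"

abbreviation brace_auto ::
  "('a, 'c) monoid_scheme \<Rightarrow> ('a \<Rightarrow> 'a \<Rightarrow> 'a) \<Rightarrow> ('a \<Rightarrow> 'a) set" where
  "brace_auto G m \<equiv> brace_iso G m G m"

definition primary_component :: "('a, 'c) monoid_scheme \<Rightarrow> nat \<Rightarrow> 'a set" where
  "primary_component G p = {x \<in> carrier G. \<exists>k. group.ord G x = p ^ k}"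

end

theory Submission
  imports Defs
begin

text \<open>
  For a brace, \<open>a \<mapsto> (x \<mapsto> a \<cdot> x \<otimes> x)\<close> is a homomorphism from the circle group
  to the automorphisms of \<open>G\<close>. The circle group of the \<open>q\<close>-component has order \<open>q\<close>, which is
  too large for it to act nontrivially on a group of order \<open>p\<^sup>2\<close> or \<open>q\<close>; so
  elements of the \<open>q\<close>-component multiply everything to zero, and both brace structures are
  determined by \<open>a \<cdot> b\<close> for \<open>a\<close> in the \<open>p\<close>-component. A brace isomorphism then restricts to
  the wanted \<open>\<phi>\<close>, because endomorphisms of a group of prime order commute; conversely \<open>\<phi>\<close>
  extends by the identity on the \<open>q\<close>-component.
\<close>

section \<open>Torsion subgroups of abelian groups\<close>

text \<open>The primary components are handled in this form: one equation in \<open>x\<close>, which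
  every endomorphism visibly preserves. For suitable \<open>n\<close> it is a primary component, see
  \<open>primary_component_eq_torsion\<close>.\<close>

definition torsion :: "('a, 'c) monoid_scheme \<Rightarrow> nat \<Rightarrow> 'a set" where
  "torsion G n = {x \<in> carrier G. x [^]\<^bsub>G\<^esub> n = \<one>\<^bsub>G\<^esub>}"

context comm_group
begin

lemma torsion_subgroup: "subgroup (torsion G n) G"
  by (rule subgroupI) (auto simp: torsion_def nat_pow_distrib nat_pow_inv intro: exI[of _ \<one>])

lemma torsion_hom:
  assumes "f \<in> hom G G" "x \<in> torsion G n"
  shows "f x \<in> torsion G n"
  using assms hom_nat_pow[of f G G x n] hom_one[of f G G] is_group
  by (auto simp: torsion_def hom_def Pi_def)

text \<open>Lagrange's theorem inside \<open>H\<close>. It will place Sylow subgroups inside torsion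
  subgroups and so bound the latter from below.\<close>

lemma subgroup_subset_torsion:
  assumes "subgroup H G"
  shows "H \<subseteq> torsion G (card H)"
proof
  fix x assume x: "x \<in> H"
  interpret H: group "G\<lparr>carrier := H\<rparr>"
    using assms by (rule subgroup_imp_group)
  show "x \<in> torsion G (card H)"
    using H.pow_order_eq_1[of x] x subgroup.mem_carrier[OF assms x]
    by (simp add: torsion_def order_def nat_pow_consistent[symmetric])
qed

lemma torsion_Int_coprime:
  assumes "coprime m n" "x \<in> torsion G m" "x \<in> torsion G n"
  shows "x = \<one>"
proof -
  have x: "x \<in> carrier G" and "ord x dvd m" "ord x dvd n"
    using assms by (auto simp: torsion_def pow_eq_id)
  then have "ord x = 1"
    using assms(1) by (metis coprime_common_divisor_nat)
  then show ?thesis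
    using ord_eq_1 x by blast
qed

text \<open>Two factorizations of one element differ by
  \<open>inv x' \<otimes> x = y' \<otimes> inv y\<close>, which lies in both torsion subgroups and
  is therefore trivial.\<close>

lemma torsion_product_inj:
  assumes "coprime m n"
  shows "inj_on (\<lambda>(x, y). x \<otimes> y) (torsion G m \<times> torsion G n)"
proof -
  interpret M: subgroup "torsion G m" G by (rule torsion_subgroup)
  interpret N: subgroup "torsion G n" G by (rule torsion_subgroup)
  have "x = x' \<and> y = y'"
    if xy: "x \<in> torsion G m" "x' \<in> torsion G m" "y \<in> torsion G n" "y' \<in> torsion G n"
      and eq: "x \<otimes> y = x' \<otimes> y'" for x y x' y'
  proof -
    have c: "x \<in> carrier G" "x' \<in> carrier G" "y \<in> carrier G" "y' \<in> carrier G"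
      using xy by auto
    have *: "inv x' \<otimes> x = y' \<otimes> inv y"
      using eq c by (metis inv_closed inv_solve_left inv_solve_right m_assoc m_closed)
    have "inv x' \<otimes> x \<in> torsion G m"
      using xy by blast
    moreover have "inv x' \<otimes> x \<in> torsion G n"
      unfolding * using xy by blast
    ultimately have "inv x' \<otimes> x = \<one>"
      using torsion_Int_coprime[OF assms] by blast
    then have "x = x'"
      using c by (metis inv_closed inv_inv inv_equality m_comm)
    then show ?thesis
      using eq c by simp
  qed
  then show ?thesis
    by (auto simp: inj_on_def)
qed

text \<open>Sylow subgroups give lower bounds for both cardinalities, and injectivity of the product
  map bounds their product by the group order. Hence equality holds throughout and the product map
  is onto.\<close>

lemma card_torsion_prime_powers:
  assumes "Factorial_Ring.prime p" "Factorial_Ring.prime q" "p \<noteq> q"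
    and ord: "order G = p ^ a * q ^ b"
  shows "card (torsion G (p ^ a)) = p ^ a"
    and "card (torsion G (q ^ b)) = q ^ b"
    and "bij_betw (\<lambda>(x, y). x \<otimes> y) (torsion G (p ^ a) \<times> torsion G (q ^ b)) (carrier G)"
proof -
  let ?P = "torsion G (p ^ a)" and ?Q = "torsion G (q ^ b)" and ?f = "\<lambda>(x, y). x \<otimes> y"
  \<comment> \<open>An infinite carrier would have order 0 by convention, so positivity of the order
    yields finiteness.\<close>
  have "p ^ a * q ^ b > 0"
    using assms by (simp add: prime_gt_0_nat)
  then have fin: "finite (carrier G)"
    using ord by (metis order_gt_0_iff_finite)
  have cop: "coprime (p ^ a) (q ^ b)"
    using assms by (simp add: primes_coprime)
  have sub: "?P \<subseteq> carrier G" "?Q \<subseteq> carrier G"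
    by (auto simp: torsion_def)
  then have fins: "finite ?P" "finite ?Q"
    using fin finite_subset by blast+
  have P: "p ^ a \<le> card ?P"
    using sylow_thm[OF assms(1) is_group ord fin] subgroup_subset_torsion fins(1)
    by (metis card_mono)
  have Q: "q ^ b \<le> card ?Q"
    using sylow_thm[OF assms(2) is_group _ fin, of b "p ^ a"] ord subgroup_subset_torsion fins(2)
    by (metis card_mono mult.commute)
  have inj: "inj_on ?f (?P \<times> ?Q)"
    by (rule torsion_product_inj[OF cop])
  have im: "?f ` (?P \<times> ?Q) \<subseteq> carrier G"
    using sub by auto
  have le: "card ?P * card ?Q \<le> p ^ a * q ^ b"
    using card_mono[OF fin im] card_image[OF inj] ord
    by (simp add: card_cartesian_product order_def)
  have pos: "p ^ a > 0" "q ^ b > 0"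
    using assms by (auto simp: prime_gt_0_nat)
  \<comment> \<open>Each time one factor in \<open>le\<close> is replaced by its Sylow lower bound,
    which then cancels.\<close>
  have "card ?P * q ^ b \<le> p ^ a * q ^ b" "p ^ a * card ?Q \<le> p ^ a * q ^ b"
    using le P Q by (meson le_trans mult_le_mono2 mult_le_mono1)+
  then show cP: "card ?P = p ^ a" and cQ: "card ?Q = q ^ b"
    using pos P Q by auto
  have "card (?f ` (?P \<times> ?Q)) = card (carrier G)"
    using card_image[OF inj] cP cQ ord by (simp add: card_cartesian_product order_def)
  then have "?f ` (?P \<times> ?Q) = carrier G"
    using card_subset_eq[OF fin im] by simp
  then show "bij_betw ?f (?P \<times> ?Q) (carrier G)"
    using inj by (simp add: bij_betw_def)
qed

text \<open>The order of an element divides \<open>p ^ a * m\<close>, so if it is a power of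
  \<open>p\<close>, coprimality with \<open>m\<close> forces it to divide
  \<open>p ^ a\<close>.\<close>

lemma primary_component_eq_torsion:
  assumes "Factorial_Ring.prime p" "order G = p ^ a * m" "coprime p m"
  shows "primary_component G p = torsion G (p ^ a)"
proof -
  have "(\<exists>k. ord x = p ^ k) \<longleftrightarrow> ord x dvd p ^ a" if x: "x \<in> carrier G" for x
  proof
    assume "\<exists>k. ord x = p ^ k"
    then obtain k where k: "ord x = p ^ k" ..
    have "p ^ k dvd p ^ a * m"
      using ord_dvd_group_order[OF x] k assms(2) by simp
    then show "ord x dvd p ^ a"
      using assms(3) k by (simp add: coprime_dvd_mult_left_iff)
  next
    assume "ord x dvd p ^ a"
    then show "\<exists>k. ord x = p ^ k"
      using divides_primepow_nat[OF assms(1)] by blast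
  qed
  then show ?thesis
    by (simp add: primary_component_def torsion_def pow_eq_id cong: conj_cong)
qed

text \<open>The torsion subgroup is cyclic of prime order, generated by any \<open>y\<close> other
  than the identity. Both maps send \<open>y\<close> to powers of \<open>y\<close>, and exponents
  multiply commutatively.\<close>

lemma endomorphisms_commute_on_prime_torsion:
  assumes q: "Factorial_Ring.prime q" "card (torsion G q) = q"
    and f: "f \<in> hom G G" and g: "g \<in> hom G G" and y: "y \<in> torsion G q"
  shows "f (g y) = g (f y)"
proof (cases "y = \<one>")
  case True
  then show ?thesis
    using hom_one[OF f is_group is_group] hom_one[OF g is_group is_group] by simp
next
  case False
  have yc: "y \<in> carrier G" and "ord y dvd q"
    using y by (auto simp: torsion_def pow_eq_id)
  then have "ord y = q"
    using q(1) False ord_eq_1 yc by (auto simp: prime_nat_iff)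
  then have card: "card (generate G {y}) = card (torsion G q)"
    using generate_pow_card[OF yc] q(2) by simp
  have "finite (torsion G q)"
    using q by (metis card.infinite not_prime_0)
  then have "generate G {y} = torsion G q"
    using card y generate_subgroup_incl[OF _ torsion_subgroup, of "{y}"]
    by (simp add: card_subset_eq)
  then have gen: "\<exists>k::int. z = y [^] k" if "z \<in> torsion G q" for z
    using generate_pow[OF yc] that by auto
  obtain k :: int where k: "f y = y [^] k"
    using gen torsion_hom[OF f y] by blast
  obtain l :: int where l: "g y = y [^] l"
    using gen torsion_hom[OF g y] by blast
  have "f (g y) = y [^] (k * l)" "g (f y) = y [^] (l * k)"
    using k l yc hom_int_pow[OF f yc] hom_int_pow[OF g yc] is_group
    by (simp_all add: int_pow_pow)
  then show ?thesis
    by (simp add: mult.commute)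
qed

end

section \<open>Fixed points of actions of groups of prime order\<close>

text \<open>Orbit lengths divide \<open>q\<close>, so they are 1 or \<open>q\<close>; the points
  that are not fixed make up the orbits of length \<open>q\<close>.\<close>

lemma (in group_action) prime_order_fixed_points:
  assumes q: "Factorial_Ring.prime q" "order G = q" and E: "finite E"
  shows "q dvd card (E - {x \<in> E. \<forall>g\<in>carrier G. \<phi> g x = x})"
proof -
  let ?F = "{x \<in> E. \<forall>g\<in>carrier G. \<phi> g x = x}"
  \<comment> \<open>The indicator of the moved points lets the count be a sum over all of
    \<open>E\<close>, split along orbits by \<open>disjoint_sum\<close>.\<close>
  let ?i = "\<lambda>x. if x \<in> ?F then 0 else 1 :: nat"
  have "q dvd (\<Sum>x\<in>orb. ?i x)" if orb: "orb \<in> orbits G E \<phi>" for orb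
  proof -
    have sub: "orb \<subseteq> E"
      using orb orbits_coverture by blast
    have orb_eq: "orb = orbit G \<phi> y" if "y \<in> orb" for y
    proof -
      have "orbit G \<phi> y \<in> orbits G E \<phi>" "y \<in> orbit G \<phi> y"
        using that sub by (auto simp: orbits_def orbit_refl)
      then show ?thesis
        using disjoint_union[OF orb] that by blast
    qed
    have dvd: "card orb dvd q"
    proof -
      obtain x where "x \<in> E" "orb = orbit G \<phi> x"
        using orb by (auto simp: orbits_def)
      then show ?thesis
        using orbit_stabilizer_theorem q(2) by (metis dvd_triv_left)
    qed
    show ?thesis
    proof (cases "\<exists>y\<in>orb. y \<in> ?F")
      case True
      then obtain y where y: "y \<in> orb" "y \<in> ?F" by blast
      have "orb \<subseteq> {y}"
        using orb_eq[OF y(1)] y(2) by (auto simp: orbit_def)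
      then have "\<forall>x\<in>orb. x \<in> ?F"
        using y(2) by blast
      then have "\<forall>x\<in>orb. ?i x = 0"
        by simp
      then have "(\<Sum>x\<in>orb. ?i x) = 0"
        by (rule sum.neutral)
      then show ?thesis by simp
    next
      case False
      then have "(\<Sum>x\<in>orb. ?i x) = (\<Sum>x\<in>orb. 1)"
        by (intro sum.cong) auto
      then have sum: "(\<Sum>x\<in>orb. ?i x) = card orb" by simp
      have "card orb \<noteq> 1"
      proof
        assume "card orb = 1"
        then obtain y where y: "orb = {y}" by (auto simp: card_1_singleton_iff)
        have "\<phi> g y = y" if "g \<in> carrier G" for g
          using orb_eq[of y] y that by (auto simp: orbit_def)
        then show False
          using False y sub by auto
      qed
      then show ?thesis
        using dvd q(1) sum by (auto simp: prime_nat_iff)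
    qed
  qed
  then have "q dvd (\<Sum>orb\<in>orbits G E \<phi>. \<Sum>x\<in>orb. ?i x)"
    by (rule dvd_sum)
  also have "\<dots> = (\<Sum>x\<in>E. ?i x)"
    by (rule disjoint_sum[OF E])
  also have "\<dots> = (\<Sum>x\<in>E - ?F. 1)"
    using E by (intro sum.mono_neutral_cong_right) auto
  finally show ?thesis by simp
qed

section \<open>The circle group and its action\<close>

text \<open>The adjoint group of the brace. The carrier \<open>H\<close> is a parameter so that the
  group can be formed on the \<open>q\<close>-component alone.\<close>

definition circle_group ::
  "('a, 'c) monoid_scheme \<Rightarrow> ('a \<Rightarrow> 'a \<Rightarrow> 'a) \<Rightarrow> 'a set \<Rightarrow> 'a monoid" where
  "circle_group G m H =
    \<lparr>carrier = H, monoid.mult = (\<lambda>a b. m a b \<otimes>\<^bsub>G\<^esub> a \<otimes>\<^bsub>G\<^esub> b), monoid.one = \<one>\<^bsub>G\<^esub>\<rparr>"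

context brace
begin

abbreviation lam :: "'a \<Rightarrow> 'a \<Rightarrow> 'a" where
  "lam a x \<equiv> a \<cdot> x \<otimes> x"

abbreviation circle :: "'a \<Rightarrow> 'a \<Rightarrow> 'a" where
  "circle a b \<equiv> a \<cdot> b \<otimes> a \<otimes> b"

declare bmult_closed [simp, intro]

lemma bmult_hom: "a \<in> carrier G \<Longrightarrow> (\<lambda>x. a \<cdot> x) \<in> hom G G"
  by (auto simp: hom_def bmult_distrib)

lemma bmult_one [simp]: "a \<in> carrier G \<Longrightarrow> a \<cdot> \<one> = \<one>"
  using hom_one[OF bmult_hom is_group is_group] by simp

lemma lam_eq_iff:
  "\<lbrakk>a \<in> carrier G; x \<in> carrier G; y \<in> carrier G\<rbrakk> \<Longrightarrow> lam a x = lam a y \<longleftrightarrow> x = y"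
  by (rule inj_on_eq_iff[OF bij_betw_imp_inj_on[OF bmult_bij]])

text \<open>The circle axiom at \<open>\<one>\<close>, \<open>\<one>\<close>, \<open>c\<close> says
  that \<open>d = \<one> \<cdot> c\<close> satisfies \<open>lam \<one> d = \<one>\<close>, and
  \<open>lam \<one>\<close> is injective.\<close>

lemma one_bmult [simp]:
  assumes c: "c \<in> carrier G"
  shows "\<one> \<cdot> c = \<one>"
proof -
  define d where "d = \<one> \<cdot> c"
  have d: "d \<in> carrier G"
    using c by (simp add: d_def)
  have "lam \<one> d \<otimes> d = d"
    using bmult_circle[OF one_closed one_closed c] by (simp add: d_def)
  then have "lam \<one> d = lam \<one> \<one>"
    using d r_cancel_one[of d "lam \<one> d"] by simp
  then show ?thesis
    unfolding d_def[symmetric] using d lam_eq_iff[of \<one> d \<one>] by blast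
qed

text \<open>This is the circle axiom with \<open>x\<close> added on both sides: \<open>lam\<close>
  turns the circle operation into composition.\<close>

lemma lam_circle:
  assumes a: "a \<in> carrier G" and b: "b \<in> carrier G" and x: "x \<in> carrier G"
  shows "lam (circle a b) x = lam a (lam b x)"
  unfolding bmult_circle[OF a b x] bmult_distrib[OF a bmult_closed[OF b x] x]
  by (rule m_assoc) (simp_all add: a b x)

lemma lam_mult:
  assumes a: "a \<in> carrier G" and x: "x \<in> carrier G" and y: "y \<in> carrier G"
  shows "lam a (x \<otimes> y) = lam a x \<otimes> lam a y"
proof -
  have "u \<otimes> v \<otimes> (x \<otimes> y) = u \<otimes> x \<otimes> (v \<otimes> y)" if "u \<in> carrier G" "v \<in> carrier G" for u v
    using that x y by (simp add: m_ac)
  then show ?thesis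
    unfolding bmult_distrib[OF a x y] using a x y by blast
qed

lemma circle_eq_lam:
  assumes a: "a \<in> carrier G" and b: "b \<in> carrier G"
  shows "circle a b = a \<otimes> lam a b"
  unfolding m_comm[OF bmult_closed[OF a b] a] by (rule m_assoc[OF a bmult_closed[OF a b] b])

text \<open>By \<open>circle_eq_lam\<close>, both sides expand to the product of \<open>a\<close>,
  \<open>lam a b\<close> and \<open>lam a (lam b c)\<close>.\<close>

lemma circle_assoc:
  assumes a: "a \<in> carrier G" and b: "b \<in> carrier G" and c: "c \<in> carrier G"
  shows "circle (circle a b) c = circle a (circle b c)"
proof -
  have closed: "lam a b \<in> carrier G" "lam b c \<in> carrier G" "lam a (lam b c) \<in> carrier G"
    "circle a b \<in> carrier G" "circle b c \<in> carrier G"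
    using assms by auto
  have "circle (circle a b) c = circle a b \<otimes> lam a (lam b c)"
    unfolding circle_eq_lam[OF closed(4) c] lam_circle[OF a b c] ..
  also have "\<dots> = a \<otimes> (lam a b \<otimes> lam a (lam b c))"
    unfolding circle_eq_lam[OF a b] using a closed by (intro m_assoc)
  also have "\<dots> = a \<otimes> lam a (b \<otimes> lam b c)"
    unfolding lam_mult[OF a b closed(2)] ..
  also have "\<dots> = circle a (circle b c)"
    unfolding circle_eq_lam[OF a closed(5)] unfolding circle_eq_lam[OF b c] ..
  finally show ?thesis .
qed

text \<open>Bijectivity on the whole group gives only injectivity on \<open>H\<close>; finiteness
  supplies surjectivity.\<close>

lemma lam_bij_left_ideal:
  assumes H: "subgroup H G" "finite H" and a: "a \<in> carrier G"
    and ideal: "\<And>x. x \<in> H \<Longrightarrow> a \<cdot> x \<in> H"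
  shows "bij_betw (lam a) H H"
proof -
  have "inj_on (lam a) H"
    using a lam_eq_iff subgroup.mem_carrier[OF H(1)] by (auto simp: inj_on_def)
  moreover have "lam a ` H \<subseteq> H"
    using ideal subgroup.m_closed[OF H(1)] by auto
  ultimately show ?thesis
    using endo_inj_surj[OF H(2)] by (simp add: bij_betw_def)
qed

lemma circle_group:
  assumes H: "subgroup H G" "finite H"
    and ideal: "\<And>a x. \<lbrakk>a \<in> H; x \<in> H\<rbrakk> \<Longrightarrow> a \<cdot> x \<in> H"
  shows "group (circle_group G (\<cdot>) H)"
proof -
  interpret H: subgroup H G by (rule H(1))
  have rinv: "\<exists>y\<in>H. circle x y = \<one>" if x: "x \<in> H" for x
  proof -
    \<comment> \<open>Since \<open>circle x y\<close> is \<open>x \<otimes> lam x y\<close>, a right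
      inverse of \<open>x\<close> is a preimage of \<open>inv x\<close> under
      \<open>lam x\<close>.\<close>
    have "inv x \<in> lam x ` H"
      using lam_bij_left_ideal[OF H, of x] ideal x by (auto simp: bij_betw_def)
    then obtain y where y: "y \<in> H" "inv x = lam x y" by blast
    have "circle x y = lam x y \<otimes> x"
      using H.mem_carrier[OF x] H.mem_carrier[OF y(1)] by (simp add: m_ac)
    also have "\<dots> = inv x \<otimes> x"
      using y(2) by simp
    also have "\<dots> = \<one>"
      using x by simp
    finally show ?thesis
      using y by blast
  qed
  have linv: "\<exists>y\<in>H. circle y x = \<one>" if x: "x \<in> H" for x
  proof -
    \<comment> \<open>Take a right inverse \<open>y\<close> of \<open>x\<close> and a right inverse
      \<open>z\<close> of \<open>y\<close>; associativity gives \<open>z = x\<close>, so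
      \<open>y\<close> is also a left inverse.\<close>
    obtain y where y: "y \<in> H" "circle x y = \<one>" using rinv x by blast
    obtain z where z: "z \<in> H" "circle y z = \<one>" using rinv y by blast
    have "x = circle x (circle y z)"
      unfolding z(2) using x by simp
    also have "\<dots> = circle (circle x y) z"
      using x y(1) z(1) by (intro circle_assoc[symmetric]) auto
    also have "\<dots> = z"
      unfolding y(2) using z(1) by simp
    finally show ?thesis
      using y z by blast
  qed
  show ?thesis
  proof (rule groupI, goal_cases)
    case (3 x y z)
    then have "circle (circle x y) z = circle x (circle y z)"
      by (intro circle_assoc H.mem_carrier) (simp_all add: circle_group_def)
    then show ?case
      by (simp add: circle_group_def)
  qed (simp_all add: circle_group_def ideal linv)
qed

text \<open>The maps are restricted to \<open>H\<close> because \<open>Bij H\<close> consists of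
  extensional functions.\<close>

lemma circle_group_action:
  assumes K: "subgroup K G" "finite K" and H: "subgroup H G" "finite H"
    and K_ideal: "\<And>a x. \<lbrakk>a \<in> K; x \<in> K\<rbrakk> \<Longrightarrow> a \<cdot> x \<in> K"
    and H_ideal: "\<And>a x. \<lbrakk>a \<in> K; x \<in> H\<rbrakk> \<Longrightarrow> a \<cdot> x \<in> H"
  shows "group_action (circle_group G (\<cdot>) K) H (\<lambda>a. \<lambda>x\<in>H. lam a x)"
proof -
  interpret K: subgroup K G by (rule K(1))
  interpret H: subgroup H G by (rule H(1))
  let ?lam = "\<lambda>a. \<lambda>x\<in>H. lam a x"
  have Bij: "?lam a \<in> Bij H" if "a \<in> K" for a
    using lam_bij_left_ideal[OF H, of a] H_ideal that by (simp add: Bij_def)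
  have "?lam (circle a b) = compose H (?lam a) (?lam b)" if "a \<in> K" "b \<in> K" for a b
  proof
    fix x
    have "lam (circle a b) x = lam a (lam b x)" if "x \<in> H"
      using \<open>a \<in> K\<close> \<open>b \<in> K\<close> that by (intro lam_circle K.mem_carrier H.mem_carrier)
    moreover have "lam b x \<in> H" if "x \<in> H"
      using \<open>b \<in> K\<close> that by (intro H.m_closed H_ideal)
    ultimately show "?lam (circle a b) x = compose H (?lam a) (?lam b) x"
      by (simp add: compose_def)
  qed
  then have "?lam \<in> hom (circle_group G (\<cdot>) K) (BijGroup H)"
    using Bij by (simp add: hom_def circle_group_def BijGroup_def K_ideal)
  then show ?thesis
    using circle_group[OF K K_ideal] group_BijGroup
    by (simp add: group_action_def group_hom_def group_hom_axioms_def)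
qed

text \<open>The condition \<open>a \<cdot> x = \<one>\<close> means \<open>lam a x = x\<close>, so
  these are the points of \<open>H\<close> fixed under the action of \<open>K\<close>.\<close>

lemma fixed_subgroup:
  assumes "subgroup H G" "K \<subseteq> carrier G"
  shows "subgroup {x \<in> H. \<forall>a\<in>K. a \<cdot> x = \<one>} G"
proof -
  interpret H: subgroup H G by fact
  have K: "a \<in> carrier G" if "a \<in> K" for a
    using that assms(2) by blast
  have inv: "a \<cdot> inv x = \<one>" if a: "a \<in> K" and x: "x \<in> H" and "a \<cdot> x = \<one>" for a x
    using bmult_distrib[OF K[OF a], of x "inv x"] that K[OF a] by simp
  show ?thesis
  proof (rule subgroupI)
    have "\<one> \<in> {x \<in> H. \<forall>a\<in>K. a \<cdot> x = \<one>}"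
      using K by simp
    then show "{x \<in> H. \<forall>a\<in>K. a \<cdot> x = \<one>} \<noteq> {}"
      by blast
    show "{x \<in> H. \<forall>a\<in>K. a \<cdot> x = \<one>} \<subseteq> carrier G"
      using H.subset by blast
  qed (simp_all add: inv K bmult_distrib)
qed

text \<open>The fixed points form a subgroup \<open>F\<close> of \<open>H\<close>, so
  \<open>card F\<close> divides \<open>card H\<close>, while \<open>q\<close> divides the number of
  moved points. Assumption \<open>arith\<close> says that these two facts leave only
  \<open>F = H\<close>.\<close>

lemma prime_order_bmult_trivial:
  assumes q: "Factorial_Ring.prime q" "card K = q"
    and K: "subgroup K G" and H: "subgroup H G" "finite H"
    and K_ideal: "\<And>a x. \<lbrakk>a \<in> K; x \<in> K\<rbrakk> \<Longrightarrow> a \<cdot> x \<in> K"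
    and H_ideal: "\<And>a x. \<lbrakk>a \<in> K; x \<in> H\<rbrakk> \<Longrightarrow> a \<cdot> x \<in> H"
    and arith: "\<And>d. \<lbrakk>d dvd card H; q dvd card H - d\<rbrakk> \<Longrightarrow> d = card H"
    and a: "a \<in> K" and x: "x \<in> H"
  shows "a \<cdot> x = \<one>"
proof -
  interpret K: subgroup K G by (rule K)
  interpret H: subgroup H G by (rule H(1))
  have finK: "finite K"
    using q by (metis card.infinite not_prime_0)
  interpret act: group_action "circle_group G (\<cdot>) K" H "\<lambda>a. \<lambda>x\<in>H. lam a x"
    by (rule circle_group_action[OF K finK H K_ideal H_ideal])
  define F where "F = {x \<in> H. \<forall>a\<in>K. a \<cdot> x = \<one>}"
  have FH: "F \<subseteq> H"
    by (auto simp: F_def)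
  have F_eq: "{x \<in> H. \<forall>a\<in>carrier (circle_group G (\<cdot>) K). (\<lambda>x\<in>H. lam a x) x = x} = F"
    by (auto simp: F_def circle_group_def)
  have "q dvd card (H - F)"
    using act.prime_order_fixed_points[of q] q H(2)
    unfolding F_eq by (simp add: order_def circle_group_def)
  then have dvd: "q dvd card H - card F"
    using FH H(2) by (simp add: card_Diff_subset finite_subset)
  have "subgroup F G"
    unfolding F_def by (rule fixed_subgroup[OF H(1) K.subset])
  then have "subgroup F (G\<lparr>carrier := H\<rparr>)"
    using FH subgroup_incl[OF _ H(1)] by blast
  then have "card F dvd card H"
    using group.lagrange[OF subgroup_imp_group[OF H(1)], of F]
    by (simp add: order_def) (metis dvd_triv_right)
  then have "F = H"
    using arith dvd FH H(2) card_subset_eq by blast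
  then show ?thesis
    using a x by (auto simp: F_def)
qed

text \<open>Left multiplication is an endomorphism of the additive group, hence preserves torsion;
  so both primary components are left ideals.\<close>

lemma torsion_left_ideal:
  "\<lbrakk>a \<in> carrier G; x \<in> torsion G n\<rbrakk> \<Longrightarrow> a \<cdot> x \<in> torsion G n"
  using torsion_hom[OF bmult_hom] by blast

end

text \<open>For \<open>d = 1\<close> the difference is \<open>(p - 1) * (p + 1)\<close>, for
  \<open>d = p\<close> it is \<open>p * (p - 1)\<close>. All these factors are positive and below
  \<open>q\<close>, so the prime \<open>q\<close> divides neither product.\<close>

lemma prime_square_arith:
  fixes p q d :: nat
  assumes p: "Factorial_Ring.prime p" and q: "Factorial_Ring.prime q" and "q > p + 1"
    and d: "d dvd p\<^sup>2" and dvd: "q dvd p\<^sup>2 - d"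
  shows "d = p\<^sup>2"
proof -
  have p2: "p \<ge> 2"
    using p prime_ge_2_nat by blast
  obtain i where i: "i \<le> 2" "d = p ^ i"
    using d divides_primepow_nat[OF p] by blast
  have small: "\<not> q dvd n" if "0 < n" "n \<le> p + 1" for n
    using that assms(3) by (auto dest: dvd_imp_le)
  have "p - 1 > 0" "p - 1 \<le> p + 1"
    using p2 by linarith+
  note nd = small[OF this] small[of p] small[of "p + 1"]
  consider "i = 0" | "i = 1" | "i = 2"
    using i(1) by linarith
  then show ?thesis
  proof cases
    case 1
    have "p\<^sup>2 - 1 = (p - 1) * (p + 1)"
      by (simp add: power2_eq_square algebra_simps diff_mult_distrib)
    then have "q dvd (p - 1) * (p + 1)"
      using dvd i 1 by simp
    then have "q dvd p - 1 \<or> q dvd p + 1"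
      using q prime_dvd_mult_iff by blast
    then show ?thesis
      using nd by simp
  next
    case 2
    have "p\<^sup>2 - p = p * (p - 1)"
      by (simp add: power2_eq_square algebra_simps diff_mult_distrib2)
    then have "q dvd p * (p - 1)"
      using dvd i 2 by simp
    then have "q dvd p \<or> q dvd p - 1"
      using q prime_dvd_mult_iff by blast
    then show ?thesis
      using nd p2 by simp
  next
    case 3
    then show ?thesis using i by simp
  qed
qed

section \<open>Vanishing of multiplication by the q-component\<close>

context brace
begin

lemma bmult_q_component_trivial:
  assumes p: "Factorial_Ring.prime p" and q: "Factorial_Ring.prime q" and pq: "q > p + 1"
    and ord: "order G = p\<^sup>2 * q"
    and a: "a \<in> torsion G q" and x: "x \<in> carrier G"
  shows "a \<cdot> x = \<one>"
proof -
  let ?P = "torsion G (p\<^sup>2)" and ?Q = "torsion G q"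
  have card: "card ?P = p\<^sup>2" "card ?Q = q"
    and bij: "bij_betw (\<lambda>(x, y). x \<otimes> y) (?P \<times> ?Q) (carrier G)"
    using card_torsion_prime_powers[OF p q, of 2 1] pq ord by auto
  have fin: "finite ?P" "finite ?Q"
    using card p q by (metis card.infinite not_prime_0 power_not_zero)+
  have sub: "?Q \<subseteq> carrier G" "?P \<subseteq> carrier G"
    by (auto simp: torsion_def)
  have ideal: "b \<cdot> y \<in> torsion G n" if "b \<in> ?Q" "y \<in> torsion G n" for b y n
    using that sub(1) by (intro torsion_left_ideal) blast+
  \<comment> \<open>Here \<open>K\<close> is \<open>?Q\<close> while \<open>H\<close> is still an
    arbitrary torsion subgroup, so the fact serves for both \<open>?P\<close> and
    \<open>?Q\<close>.\<close>
  note trivial = prime_order_bmult_trivial[OF q card(2) torsion_subgroup torsion_subgroup _ ideal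
      ideal _ a]
  have "a \<cdot> u = \<one>" if "u \<in> ?P" for u
    using trivial[OF fin(1) _ _ _ _ _ that] prime_square_arith[OF p q pq] card(1) by simp
  \<comment> \<open>The arithmetic condition for the action of \<open>?Q\<close> on itself: the
    other divisor, 1, would make \<open>q\<close> divide \<open>q - 1\<close>.\<close>
  moreover have "d = q" if "d dvd q" "q dvd q - d" for d
  proof (rule ccontr)
    assume "d \<noteq> q"
    then have "d = 1"
      using q that(1) by (auto simp: prime_nat_iff)
    then show False
      using that(2) prime_gt_1_nat[OF q] by (auto dest: dvd_imp_le)
  qed
  then have "a \<cdot> v = \<one>" if "v \<in> ?Q" for v
    using trivial[OF fin(2) _ _ _ _ _ that] card(2) by simp
  moreover obtain u v where uv: "u \<in> ?P" "v \<in> ?Q" "x = u \<otimes> v"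
    using bij x by (force simp: bij_betw_def)
  moreover have "a \<in> carrier G" "u \<in> carrier G" "v \<in> carrier G"
    using sub a uv by blast+
  ultimately show ?thesis
    by (simp add: bmult_distrib)
qed

text \<open>Since \<open>b\<close> multiplies everything to zero, \<open>a \<otimes> b\<close>
  equals \<open>circle b a\<close>, and the circle axiom then leaves only
  \<open>a \<cdot> c\<close>.\<close>

lemma bmult_p_part:
  assumes "Factorial_Ring.prime p" "Factorial_Ring.prime q" "q > p + 1" "order G = p\<^sup>2 * q"
    and a: "a \<in> carrier G" and b: "b \<in> torsion G q" and c: "c \<in> carrier G"
  shows "(a \<otimes> b) \<cdot> c = a \<cdot> c"
proof -
  have bc: "b \<in> carrier G"
    using b by (simp add: torsion_def)
  have b_zero: "b \<cdot> x = \<one>" if "x \<in> carrier G" for x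
    using bmult_q_component_trivial[OF assms(1-4) b that] .
  \<comment> \<open>The factor \<open>b\<close> must come first: \<open>b \<cdot> a\<close>
    vanishes, whereas \<open>a \<cdot> b\<close> may not.\<close>
  have "(a \<otimes> b) \<cdot> c = (b \<cdot> a \<otimes> b \<otimes> a) \<cdot> c"
    unfolding b_zero[OF a] m_comm[OF a bc] using a bc by simp
  also have "\<dots> = b \<cdot> (a \<cdot> c) \<otimes> b \<cdot> c \<otimes> a \<cdot> c"
    by (rule bmult_circle[OF bc a c])
  also have "\<dots> = a \<cdot> c"
    using a c by (simp add: b_zero)
  finally show ?thesis .
qed

end

section \<open>The isomorphism criterion\<close>

theorem corollary2:
  fixes A :: "('a, 'c) monoid_scheme"
    and p q :: nat
    and m1 m2 :: "'a \<Rightarrow> 'a \<Rightarrow> 'a"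
  assumes "Factorial_Ring.prime p" and "Factorial_Ring.prime q" and "q > p + 1"
    and "comm_group A" and "Coset.order A = p\<^sup>2 * q"
    and "brace A m1" and "brace A m2"
    and "\<forall>a\<in>primary_component A p. \<forall>a'\<in>primary_component A p. m1 a a' = m2 a a'"
  shows "braces_isomorphic A m1 A m2 \<longleftrightarrow>
    (\<exists>\<phi> \<in> brace_auto (A\<lparr>carrier := primary_component A p\<rparr>) m1.
      \<forall>a\<in>primary_component A p. \<forall>b\<in>primary_component A q. m2 (\<phi> a) b = m1 a b)"
proof -
  interpret B1: brace A m1 by fact
  interpret B2: brace A m2 by fact
  define P where "P = torsion A (p\<^sup>2)"
  define Q where "Q = torsion A q"
  have cop: "coprime p q"
    using assms(1-3) by (simp add: primes_coprime)
  have PQ: "primary_component A p = P" "primary_component A q = Q"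
    using B1.primary_component_eq_torsion[OF assms(1), of 2 q] cop
      B1.primary_component_eq_torsion[OF assms(2), of 1 "p\<^sup>2"] assms(5)
    by (simp_all add: P_def Q_def coprime_commute mult.commute)
  have card: "card P = p\<^sup>2" "card Q = q"
    and bij: "bij_betw (\<lambda>(x, y). x \<otimes>\<^bsub>A\<^esub> y) (P \<times> Q) (carrier A)"
    using B1.card_torsion_prime_powers[OF assms(1,2), of 2 1] assms(3,5)
    by (auto simp: P_def Q_def)
  have fin: "finite P"
    using card assms(1) by (metis card.infinite not_prime_0 power_not_zero)
  interpret P: subgroup P A unfolding P_def by (rule B1.torsion_subgroup)
  interpret Q: subgroup Q A unfolding Q_def by (rule B1.torsion_subgroup)
  have m1_P: "m1 a b \<in> P" if "a \<in> P" "b \<in> P" for a b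
    using that B1.torsion_left_ideal[of a b "p\<^sup>2"] P.mem_carrier by (simp add: P_def)
  have m1_Q: "m1 a b \<in> Q" if "a \<in> P" "b \<in> Q" for a b
    using that B1.torsion_left_ideal[of a b q] P.mem_carrier by (simp add: Q_def)
  have eq: "m2 a a' = m1 a a'" if "a \<in> P" "a' \<in> P" for a a'
    using assms(8) that PQ by simp
  note m1_part = B1.bmult_p_part[OF assms(1-3,5), folded Q_def]
    and m2_part = B2.bmult_p_part[OF assms(1-3,5), folded Q_def]
  show ?thesis unfolding PQ
  proof
    assume "braces_isomorphic A m1 A m2"
    then obtain f where f: "f \<in> hom A A" "bij_betw f (carrier A) (carrier A)"
      and fm: "\<And>a b. \<lbrakk>a \<in> carrier A; b \<in> carrier A\<rbrakk> \<Longrightarrow> f (m1 a b) = m2 (f a) (f b)"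
      by (auto simp: braces_isomorphic_def brace_iso_def iso_def)
    have fP: "f a \<in> P" if "a \<in> P" for a
      using B1.torsion_hom[OF f(1)] that by (simp add: P_def)
    have fQ: "f a \<in> Q" if "a \<in> Q" for a
      using B1.torsion_hom[OF f(1)] that by (simp add: Q_def)
    have inj: "inj_on f (carrier A)"
      using f(2) by (simp add: bij_betw_def)
    have "inj_on f P"
      by (rule inj_on_subset[OF inj P.subset])
    then have "bij_betw f P P"
      using endo_inj_surj[OF fin] fP by (auto simp: bij_betw_def)
    \<comment> \<open>\<open>f\<close> carries \<open>m1\<close> to \<open>m2\<close>, but its
      values on \<open>P\<close> stay in \<open>P\<close>, where \<open>eq\<close> turns
      \<open>m2\<close> back into \<open>m1\<close>.\<close>
    then have auto: "f \<in> brace_auto (A\<lparr>carrier := P\<rparr>) m1"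
      using f(1) fP fm eq by (auto simp: brace_iso_def iso_def hom_def Pi_def)
    have "m2 (f a) b = m1 a b" if a: "a \<in> P" and b: "b \<in> Q" for a b
    proof -
      have "f (m1 a b) = m2 (f a) (f b)"
        using fm a b by simp
      \<comment> \<open>On \<open>Q\<close>, of prime order, the endomorphism \<open>f\<close>
        commutes with left multiplication by \<open>f a\<close>; afterwards \<open>f\<close> can be
        cancelled.\<close>
      also have "\<dots> = f (m2 (f a) b)"
        using B1.endomorphisms_commute_on_prime_torsion[OF assms(2) card(2)[unfolded Q_def] f(1)
            B2.bmult_hom b[unfolded Q_def], of "f a"] fP[OF a] by simp
      finally have "f (m2 (f a) b) = f (m1 a b)" ..
      moreover have "m1 a b \<in> carrier A" "m2 (f a) b \<in> carrier A"
        using a b fP[OF a] by auto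
      ultimately show ?thesis
        using inj_onD[OF inj] by blast
    qed
    with auto show "\<exists>\<phi>\<in>brace_auto (A\<lparr>carrier := P\<rparr>) m1. \<forall>a\<in>P. \<forall>b\<in>Q. m2 (\<phi> a) b = m1 a b"
      by blast
  next
    assume "\<exists>\<phi>\<in>brace_auto (A\<lparr>carrier := P\<rparr>) m1. \<forall>a\<in>P. \<forall>b\<in>Q. m2 (\<phi> a) b = m1 a b"
    then obtain \<phi> where \<phi>: "\<phi> \<in> brace_auto (A\<lparr>carrier := P\<rparr>) m1"
      and \<phi>Q: "\<And>a b. \<lbrakk>a \<in> P; b \<in> Q\<rbrakk> \<Longrightarrow> m2 (\<phi> a) b = m1 a b"
      by blast
    have bij\<phi>: "bij_betw \<phi> P P"
      and \<phi>_add: "\<And>a b. \<lbrakk>a \<in> P; b \<in> P\<rbrakk> \<Longrightarrow> \<phi> (a \<otimes>\<^bsub>A\<^esub> b) = \<phi> a \<otimes>\<^bsub>A\<^esub> \<phi> b"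
      and \<phi>_mult: "\<And>a b. \<lbrakk>a \<in> P; b \<in> P\<rbrakk> \<Longrightarrow> \<phi> (m1 a b) = m1 (\<phi> a) (\<phi> b)"
      using \<phi> by (auto simp: brace_iso_def iso_def hom_def)
    have \<phi>P: "\<phi> a \<in> P" if "a \<in> P" for a
      using bij\<phi> that by (auto simp: bij_betw_def)
    define s where "s = (\<lambda>(x, y). x \<otimes>\<^bsub>A\<^esub> y)"
    \<comment> \<open>This is \<open>\<phi>\<close> on \<open>P\<close> and the identity on
      \<open>Q\<close>, transported to the carrier along the bijection \<open>s\<close>.\<close>
    define f where "f = s \<circ> map_prod \<phi> id \<circ> inv_into (P \<times> Q) s"
    have s: "bij_betw s (P \<times> Q) (carrier A)"
      using bij by (simp add: s_def)
    have f_apply: "f (u \<otimes>\<^bsub>A\<^esub> v) = \<phi> u \<otimes>\<^bsub>A\<^esub> v" if "u \<in> P" "v \<in> Q" for u v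
    proof -
      have "inv_into (P \<times> Q) s (s (u, v)) = (u, v)"
        using s that by (intro inv_into_f_f) (auto simp: bij_betw_def)
      then show ?thesis
        by (simp add: f_def s_def)
    qed
    have "bij_betw (map_prod \<phi> id) (P \<times> Q) (P \<times> Q)"
      using bij\<phi> by (intro bij_betw_map_prod) auto
    then have f_bij: "bij_betw f (carrier A) (carrier A)"
      unfolding f_def using s bij_betw_inv_into[OF s] by (blast intro: bij_betw_trans)
    have split: "\<exists>u\<in>P. \<exists>v\<in>Q. x = u \<otimes>\<^bsub>A\<^esub> v" if "x \<in> carrier A" for x
    proof -
      have "x \<in> s ` (P \<times> Q)"
        using s that by (simp only: bij_betw_imp_surj_on)
      then show ?thesis
        by (clarsimp simp: s_def) blast
    qed
    have f_add: "f (x \<otimes>\<^bsub>A\<^esub> y) = f x \<otimes>\<^bsub>A\<^esub> f y" and f_mult: "f (m1 x y) = m2 (f x) (f y)"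
      if xy: "x \<in> carrier A" "y \<in> carrier A" for x y
    proof -
      obtain u v where uv: "u \<in> P" "v \<in> Q" "x = u \<otimes>\<^bsub>A\<^esub> v" using split xy by blast
      obtain u' v' where uv': "u' \<in> P" "v' \<in> Q" "y = u' \<otimes>\<^bsub>A\<^esub> v'" using split xy by blast
      note c = \<phi>P[OF uv(1)] \<phi>P[OF uv'(1)] uv(1,2) uv'(1,2)
      have "x \<otimes>\<^bsub>A\<^esub> y = (u \<otimes>\<^bsub>A\<^esub> u') \<otimes>\<^bsub>A\<^esub> (v \<otimes>\<^bsub>A\<^esub> v')"
        using uv uv' by (simp add: B1.m_ac)
      then have "f (x \<otimes>\<^bsub>A\<^esub> y) = \<phi> (u \<otimes>\<^bsub>A\<^esub> u') \<otimes>\<^bsub>A\<^esub> (v \<otimes>\<^bsub>A\<^esub> v')"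
        using f_apply c by simp
      then show "f (x \<otimes>\<^bsub>A\<^esub> y) = f x \<otimes>\<^bsub>A\<^esub> f y"
        using c by (simp add: \<phi>_add uv(3) uv'(3) f_apply B1.m_ac)
      \<comment> \<open>The left factor loses its \<open>Q\<close>-part \<open>v\<close> by
        \<open>m1_part\<close>; distributivity splits the right factor.\<close>
      have "m1 x y = m1 u u' \<otimes>\<^bsub>A\<^esub> m1 u v'"
        using c by (simp add: uv(3) uv'(3) m1_part B1.bmult_distrib)
      then have "f (m1 x y) = m1 (\<phi> u) (\<phi> u') \<otimes>\<^bsub>A\<^esub> m1 u v'"
        using c by (simp add: f_apply m1_P m1_Q \<phi>_mult)
      \<comment> \<open>The summand in \<open>P\<close> passes from \<open>m1\<close> to
        \<open>m2\<close> by \<open>eq\<close>, the summand in \<open>Q\<close> by the hypothesis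
        \<open>\<phi>Q\<close>; \<open>m2_part\<close> disposes of \<open>v\<close>.\<close>
      also have "\<dots> = m2 (\<phi> u \<otimes>\<^bsub>A\<^esub> v) (\<phi> u' \<otimes>\<^bsub>A\<^esub> v')"
        using c by (simp add: m2_part B2.bmult_distrib eq \<phi>Q)
      finally show "f (m1 x y) = m2 (f x) (f y)"
        using c by (simp add: uv(3) uv'(3) f_apply)
    qed
    have "f \<in> brace_iso A m1 A m2"
      using f_bij f_add f_mult by (auto simp: brace_iso_def iso_def hom_def bij_betw_def)
    then show "braces_isomorphic A m1 A m2"
      by (auto simp: braces_isomorphic_def)
  qed
qed

end
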